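(* Let $h\ge 3$ be an integer and, for each $m\ge 1$, let $O_m$ denote the ortho-chain of length $m$ all of whose cycles have $h$ vertices. Then for every $n\ge 3$ the independence polynomials satisfy $$i(O_n;x)=x\cdot i(P_{h-3};x)^2\cdot i(O_{n-2};x)+i(P_{h-2};x)\cdot i(O_{n-1};x).$$
   Context: All graphs are finite and simple. The independence polynomial of a graph $G$ is $i(G;x)=\sum_{k=0}^{\alpha(G)}\Psi_k(G)x^k$, where $\Psi_k(G)$ is the number of independent sets of $G$ with exactly $k$ vertices and $\alpha(G)$ is the independence number (largest size of an independent set). $P_m$ is the path on $m$ vertices; $P_0$ is the empty graph, with $i(P_0;x)=1$. A cactus is a connected graph in which each edge lies in at most one cycle. A chain cactus is a cactus in which each block is a cycle containing at most two cut vertices and each cut vertex is contained in exactly two cycles; its length is the number of its cycles. A chain $h$-cactus is a chain cactus all of whose cycles have exactly $h$ vertices. In a chain cactus of length $n$ the cycles are denoted $C^{(1)},\dots,C^{(n)}$ in their order along the chain (consecutive cycles share one cut vertex). Internal cycles are $C^{(2)},\dots,C^{(n-1)}$; each contains exactly two cut vertices. An internal cycle is in $k$-position if its two cut vertices are at distance $k$ (in the cycle); $1$-position is called ortho-position. The ortho-chain $O_n$ is the chain $h$-cactus of length $n$ (unique up to isomorphism) all of whose internal cycles are in ortho-position; $O_1$ is the cycle $C_h$, and $O_2$ is two $h$-cycles sharing one vertex. *)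

theory Defs
  imports "HOL-Computational_Algebra.Polynomial"
begin

record 'a ugraph =
  verts :: "'a set"
  edges :: "'a set set"

definition simple_graph :: "'a ugraph \<Rightarrow> bool" where
  "simple_graph G \<longleftrightarrow>
     finite (verts G) \<and> (\<forall>e\<in>edges G. e \<subseteq> verts G \<and> card e = 2)"

definition subgraph :: "'a ugraph \<Rightarrow> 'a ugraph \<Rightarrow> bool" where
  "subgraph H G \<longleftrightarrow> simple_graph H \<and> verts H \<subseteq> verts G \<and> edges H \<subseteq> edges G"

definition del_vertex :: "'a ugraph \<Rightarrow> 'a \<Rightarrow> 'a ugraph" where
  "del_vertex G v = \<lparr>verts = verts G - {v}, edges = {e \<in> edges G. v \<notin> e}\<rparr>"


section \<open>The independence polynomial\<close>

definition indep_set :: "'a ugraph \<Rightarrow> 'a set \<Rightarrow> bool" where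
  "indep_set G S \<longleftrightarrow> S \<subseteq> verts G \<and> (\<forall>e\<in>edges G. \<not> e \<subseteq> S)"

definition indep_number :: "'a ugraph \<Rightarrow> nat" where
  "indep_number G = Max {card S | S. indep_set G S}"

definition indep_count :: "'a ugraph \<Rightarrow> nat \<Rightarrow> nat" where
  "indep_count G k = card {S. indep_set G S \<and> card S = k}"

definition indep_poly :: "'a ugraph \<Rightarrow> int poly" where
  "indep_poly G = (\<Sum>k = 0..indep_number G. monom (int (indep_count G k)) k)"

definition path_graph :: "nat \<Rightarrow> nat ugraph" where
  "path_graph m = \<lparr>verts = {0..<m}, edges = {{i, Suc i} | i. Suc i < m}\<rparr>"


section \<open>Connectivity, cycles and blocks\<close>

definition adj :: "'a ugraph \<Rightarrow> ('a \<times> 'a) set" where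
  "adj G = {(u, v). {u, v} \<in> edges G}"

definition graph_connected :: "'a ugraph \<Rightarrow> bool" where
  "graph_connected G \<longleftrightarrow>
     verts G \<noteq> {} \<and> (\<forall>u\<in>verts G. \<forall>v\<in>verts G. (u, v) \<in> (adj G)\<^sup>*)"

text \<open>Only meaningful for vertices in the same component.\<close>

definition graph_dist :: "'a ugraph \<Rightarrow> 'a \<Rightarrow> 'a \<Rightarrow> nat" where
  "graph_dist G u v = (LEAST k. (u, v) \<in> adj G ^^ k)"

text \<open>A cut vertex separates two other vertices of its component; equivalently, its deletion
  increases the number of components.\<close>

definition cut_vertex :: "'a ugraph \<Rightarrow> 'a \<Rightarrow> bool" where
  "cut_vertex G v \<longleftrightarrow> v \<in> verts G \<and>
     (\<exists>u\<in>verts G - {v}. \<exists>w\<in>verts G - {v}.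
        (u, w) \<in> (adj G)\<^sup>* \<and> (u, w) \<notin> (adj (del_vertex G v))\<^sup>*)"

definition cycle_graph :: "'a ugraph \<Rightarrow> bool" where
  "cycle_graph C \<longleftrightarrow>
     (\<exists>vs. distinct vs \<and> 3 \<le> length vs \<and> verts C = set vs \<and>
           edges C = {{vs ! i, vs ! (Suc i mod length vs)} | i. i < length vs})"

definition cycles :: "'a ugraph \<Rightarrow> 'a ugraph set" where
  "cycles G = {C. subgraph C G \<and> cycle_graph C}"

definition block :: "'a ugraph \<Rightarrow> 'a ugraph \<Rightarrow> bool" where
  "block G B \<longleftrightarrow>
     subgraph B G \<and> graph_connected B \<and> (\<nexists>v. cut_vertex B v) \<and>
     (\<forall>B'. subgraph B' G \<and> graph_connected B' \<and> (\<nexists>v. cut_vertex B' v) \<and> subgraph B B'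
           \<longrightarrow> B' = B)"


section \<open>Cacti\<close>

definition cactus :: "'a ugraph \<Rightarrow> bool" where
  "cactus G \<longleftrightarrow> simple_graph G \<and> graph_connected G \<and>
     (\<forall>e\<in>edges G. \<forall>C\<in>cycles G. \<forall>D\<in>cycles G. e \<in> edges C \<and> e \<in> edges D \<longrightarrow> C = D)"

definition chain_cactus :: "'a ugraph \<Rightarrow> bool" where
  "chain_cactus G \<longleftrightarrow> cactus G \<and>
     (\<forall>B. block G B \<longrightarrow> cycle_graph B \<and> card {v \<in> verts B. cut_vertex G v} \<le> 2) \<and>
     (\<forall>v. cut_vertex G v \<longrightarrow> card {C \<in> cycles G. v \<in> verts C} = 2)"

definition chain_length :: "'a ugraph \<Rightarrow> nat" where
  "chain_length G = card (cycles G)"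

definition chain_h_cactus :: "nat \<Rightarrow> 'a ugraph \<Rightarrow> bool" where
  "chain_h_cactus h G \<longleftrightarrow> chain_cactus G \<and> (\<forall>C\<in>cycles G. card (verts C) = h)"

text \<open>The list \<open>Cs\<close> enumerates all cycles of \<open>G\<close> in their order along the chain.\<close>

definition chain_order :: "'a ugraph \<Rightarrow> 'a ugraph list \<Rightarrow> bool" where
  "chain_order G Cs \<longleftrightarrow> distinct Cs \<and> set Cs = cycles G \<and>
     (\<forall>i. Suc i < length Cs \<longrightarrow>
        (\<exists>v. cut_vertex G v \<and> verts (Cs ! i) \<inter> verts (Cs ! Suc i) = {v}))"

text \<open>The distance is measured in the cycle \<open>C\<close>, the cut vertices are those of \<open>G\<close>.\<close>

definition in_position :: "'a ugraph \<Rightarrow> 'a ugraph \<Rightarrow> nat \<Rightarrow> bool" where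
  "in_position G C k \<longleftrightarrow>
     (\<exists>u v. u \<noteq> v \<and> {w \<in> verts C. cut_vertex G w} = {u, v} \<and> graph_dist C u v = k)"

definition ortho_chain :: "nat \<Rightarrow> nat \<Rightarrow> 'a ugraph \<Rightarrow> bool" where
  "ortho_chain h n G \<longleftrightarrow> chain_h_cactus h G \<and> chain_length G = n \<and>
     (\<exists>Cs. chain_order G Cs \<and>
        (\<forall>i. 0 < i \<and> Suc i < length Cs \<longrightarrow> in_position G (Cs ! i) 1))"

end

theory Submission
  imports Defs
begin

text \<open>Attach the cycles of the chain one at a time. For the part of the chain built so far, let \<open>r\<close>
  and \<open>s\<close> enumerate the independent sets that avoid, respectively contain, the vertex \<open>w\<close> at which the
  next cycle is glued. In an ortho-chain the following gluing vertex \<open>w'\<close> is adjacent to \<open>w\<close>, and the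
  remaining \<open>h - 2\<close> vertices of the new cycle form a path from \<open>w'\<close> back to \<open>w\<close>, so with
  \<open>p k = i(P_k; x)\<close> the pair becomes \<open>r' = r p (h - 2) + s p (h - 3)\<close>, \<open>s' = x r p (h - 3)\<close>.
  Starting from a single vertex, this linear recursion determines \<open>i(O_n; x) = r + s\<close> and implies
  the three-term recurrence.\<close>

section \<open>Generating functions of set families\<close>

text \<open>One monomial per set, rather than one per cardinality as in \<open>indep_poly\<close>,
  so that disjoint unions become sums and independent choices on disjoint vertex sets become
  products.\<close>

definition set_gf :: "'a set set \<Rightarrow> int poly" where
  "set_gf F = (\<Sum>S\<in>F. monom 1 (card S))"

lemma finite_indep_sets: "finite (verts G) \<Longrightarrow> finite {S. indep_set G S}"
  by (rule finite_subset[of _ "Pow (verts G)"]) (auto simp: indep_set_def)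

text \<open>The sum over all independent sets is grouped by cardinality; none exceeds the
  independence number.\<close>

lemma indep_poly_eq_set_gf:
  assumes fin: "finite (verts G)"
  shows "indep_poly G = set_gf {S. indep_set G S}"
proof -
  let ?I = "{S. indep_set G S}"
  have finI: "finite ?I" by (rule finite_indep_sets[OF fin])
  have img: "{card S |S. indep_set G S} = card ` ?I" by auto
  have le: "card ` ?I \<subseteq> {0..indep_number G}"
    unfolding indep_number_def img using finI by (auto intro!: Max_ge)
  have coeff: "monom (int (indep_count G k)) k = (\<Sum>S | S \<in> ?I \<and> card S = k. monom 1 (card S))" for k
  proof -
    have "(\<Sum>S | S \<in> ?I \<and> card S = k. monom (1::int) (card S)) = (\<Sum>S | S \<in> ?I \<and> card S = k. monom 1 k)"
      by (rule sum.cong) auto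
    also have "\<dots> = monom (int (indep_count G k)) k"
      by (simp add: indep_count_def of_nat_monom mult_monom)
    finally show ?thesis by simp
  qed
  show ?thesis
    unfolding indep_poly_def set_gf_def coeff
    by (rule sum.group[OF finI _ le]) simp
qed

lemma set_gf_Un_disjoint:
  "finite F \<Longrightarrow> finite F' \<Longrightarrow> F \<inter> F' = {} \<Longrightarrow> set_gf (F \<union> F') = set_gf F + set_gf F'"
  unfolding set_gf_def by (rule sum.union_disjoint)

text \<open>Each \<open>S\<close> is determined by its traces on \<open>V\<close> and
  \<open>W\<close>, which are chosen independently and whose cardinalities add up.\<close>

lemma set_gf_product:
  assumes fin: "finite V" "finite W" and disj: "V \<inter> W = {}"
    and sub: "F \<subseteq> Pow V" "F' \<subseteq> Pow W"
  shows "set_gf {S. S \<subseteq> V \<union> W \<and> S \<inter> V \<in> F \<and> S \<inter> W \<in> F'} = set_gf F * set_gf F'"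
proof -
  let ?P = "{S. S \<subseteq> V \<union> W \<and> S \<inter> V \<in> F \<and> S \<inter> W \<in> F'}"
  have "set_gf F * set_gf F' = (\<Sum>(T, A)\<in>F \<times> F'. monom 1 (card T) * monom 1 (card A))"
    unfolding set_gf_def by (simp add: sum_product sum.cartesian_product)
  also have "\<dots> = set_gf ?P"
    unfolding set_gf_def
  proof (rule sum.reindex_bij_witness[of _ "\<lambda>S. (S \<inter> V, S \<inter> W)" "\<lambda>(T, A). T \<union> A"])
    fix p assume p: "p \<in> F \<times> F'"
    obtain T A where [simp]: "p = (T, A)" by (cases p)
    have T: "T \<in> F" "T \<subseteq> V" and A: "A \<in> F'" "A \<subseteq> W" using p sub by auto
    have eqs: "(T \<union> A) \<inter> V = T" "(T \<union> A) \<inter> W = A" using T A disj by auto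
    then show "(case case p of (T, A) \<Rightarrow> T \<union> A of S \<Rightarrow> (S \<inter> V, S \<inter> W)) = p"
      by simp
    show "(case p of (T, A) \<Rightarrow> T \<union> A) \<in> ?P" using eqs T A by auto
    have "card (T \<union> A) = card T + card A"
      by (rule card_Un_disjoint) (use T A disj fin finite_subset in blast)+
    then show "monom (1::int) (card (case p of (T, A) \<Rightarrow> T \<union> A))
        = (case p of (T, A) \<Rightarrow> monom 1 (card T) * monom 1 (card A))"
      by (simp add: mult_monom)
  next
    fix S assume "S \<in> ?P"
    then show "(case (S \<inter> V, S \<inter> W) of (T, A) \<Rightarrow> T \<union> A) = S" "(S \<inter> V, S \<inter> W) \<in> F \<times> F'" by auto
  qed
  finally show ?thesis by simp
qed

lemma set_gf_insert_image:
  assumes "finite W" "x \<notin> W" "F \<subseteq> Pow W"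
  shows "set_gf (insert x ` F) = monom 1 1 * set_gf F"
proof -
  have "x \<notin> A" if "A \<in> F" for A using that assms by blast
  then have inj: "inj_on (insert x) F" by (intro inj_onI) (metis insert_ident)
  have "card (insert x A) = Suc (card A)" if "A \<in> F" for A
    using that assms finite_subset by (metis PowD card_insert_disjoint subsetD)
  then show ?thesis
    unfolding set_gf_def by (simp add: sum.reindex[OF inj] sum_distrib_left mult_monom)
qed

section \<open>Paths and cycles as vertex lists\<close>

text \<open>Vertex lists turn cutting, joining and reversing of paths into list operations.
  Repetitions are allowed, so that a cycle can be written as the closed walk
  \<open>u # xs @ [u]\<close>.\<close>

definition path_edges :: "'a list \<Rightarrow> 'a set set" where
  "path_edges xs = {{xs ! i, xs ! Suc i} | i. Suc i < length xs}"

definition path_indep :: "'a list \<Rightarrow> 'a set set" where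
  "path_indep xs = {A. A \<subseteq> set xs \<and> (\<forall>e\<in>path_edges xs. \<not> e \<subseteq> A)}"

lemma path_edges_Nil [simp]: "path_edges [] = {}"
  and path_edges_single [simp]: "path_edges [x] = {}"
  by (auto simp: path_edges_def)

lemma path_edges_Cons [simp]:
  "path_edges (x # y # xs) = insert {x, y} (path_edges (y # xs))"
proof -
  have "{i. Suc i < length (x # y # xs)} = insert 0 (Suc ` {i. Suc i < length (y # xs)})"
    by (auto simp: image_iff gr0_conv_Suc) (metis Suc_less_eq not0_implies_Suc)
  moreover have "path_edges zs = (\<lambda>i. {zs ! i, zs ! Suc i}) ` {i. Suc i < length zs}" for zs :: "'a list"
    by (auto simp: path_edges_def)
  ultimately show ?thesis by (simp add: image_image)
qed

lemma path_edges_append: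
  "path_edges (xs @ y # ys) = path_edges (xs @ [y]) \<union> path_edges (y # ys)"
proof (induction xs)
  case (Cons x xs)
  then show ?case by (cases xs) auto
qed simp

lemma path_edges_snoc [simp]:
  "path_edges (xs @ [y, z]) = insert {y, z} (path_edges (xs @ [y]))"
  using path_edges_append[of xs y "[z]"] by auto

lemma path_edges_rev: "path_edges (rev xs) = path_edges xs"
proof (induction xs)
  case (Cons x xs)
  then show ?case by (cases xs) auto
qed simp

lemma path_edges_subset: "e \<in> path_edges xs \<Longrightarrow> e \<subseteq> set xs"
  by (auto simp: path_edges_def)

lemma path_indep_subset: "path_indep xs \<subseteq> Pow (set xs)"
  by (auto simp: path_indep_def)

lemma path_indep_iff:
  "A \<in> path_indep xs \<longleftrightarrow>
     A \<subseteq> set xs \<and> (\<forall>i. Suc i < length xs \<longrightarrow> \<not> (xs ! i \<in> A \<and> xs ! Suc i \<in> A))"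
proof -
  have "(\<forall>e\<in>path_edges xs. \<not> e \<subseteq> A) \<longleftrightarrow>
      (\<forall>i. Suc i < length xs \<longrightarrow> \<not> {xs ! i, xs ! Suc i} \<subseteq> A)"
    unfolding path_edges_def by blast
  then show ?thesis by (simp add: path_indep_def)
qed

lemma indep_set_path_graph_iff:
  "indep_set (path_graph n) A \<longleftrightarrow> A \<subseteq> {0..<n} \<and> (\<forall>i. Suc i < n \<longrightarrow> \<not> (i \<in> A \<and> Suc i \<in> A))"
proof -
  have "(\<forall>e\<in>edges (path_graph n). \<not> e \<subseteq> A) \<longleftrightarrow> (\<forall>i. Suc i < n \<longrightarrow> \<not> {i, Suc i} \<subseteq> A)"
    unfolding path_graph_def by auto
  then show ?thesis by (simp add: indep_set_def path_graph_def)
qed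

text \<open>The map from positions to entries is injective, hence preserves cardinalities, and it
  takes consecutive positions to consecutive entries.\<close>

lemma set_gf_path_indep:
  assumes "distinct xs"
  shows "set_gf (path_indep xs) = indep_poly (path_graph (length xs))"
proof -
  let ?n = "length xs"
  have inj: "inj_on ((!) xs) {0..<?n}" using assms by (simp add: inj_on_nth)
  have setxs: "set xs = (!) xs ` {0..<?n}" by (auto simp: in_set_conv_nth)
  have iff: "(!) xs ` A \<in> path_indep xs \<longleftrightarrow> indep_set (path_graph ?n) A" if A: "A \<subseteq> {0..<?n}" for A
  proof -
    have "xs ! i \<in> (!) xs ` A \<longleftrightarrow> i \<in> A" if "i < ?n" for i
      using inj_on_image_mem_iff[OF inj _ A] that by simp
    moreover have "(!) xs ` A \<subseteq> set xs" using A setxs by blast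
    ultimately show ?thesis
      using A by (auto simp: path_indep_iff indep_set_path_graph_iff)
  qed
  have eq: "path_indep xs = (`) ((!) xs) ` {S. indep_set (path_graph ?n) S}" (is "?L = ?R")
  proof
    show "?L \<subseteq> ?R"
    proof
      fix B assume B: "B \<in> ?L"
      then have "B \<subseteq> (!) xs ` {0..<?n}" using setxs by (auto simp: path_indep_def)
      then obtain A where A: "A \<subseteq> {0..<?n}" "B = (!) xs ` A" by (auto simp: subset_image_iff)
      then have "indep_set (path_graph ?n) A" using iff B by blast
      then show "B \<in> ?R" using A by blast
    qed
    show "?R \<subseteq> ?L" using iff by (auto simp: indep_set_def path_graph_def)
  qed
  have sub: "S \<subseteq> {0..<?n}" if "indep_set (path_graph ?n) S" for S
    using that by (auto simp: indep_set_def path_graph_def)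
  have inj2: "inj_on ((`) ((!) xs)) {S. indep_set (path_graph ?n) S}"
    by (rule inj_on_subset[OF inj_on_image_Pow[OF inj]]) (use sub in auto)
  have "set_gf (path_indep xs) = set_gf {S. indep_set (path_graph ?n) S}"
    unfolding eq set_gf_def sum.reindex[OF inj2]
    by (rule sum.cong) (auto dest!: sub simp: card_image inj_on_subset[OF inj])
  then show ?thesis by (simp add: indep_poly_eq_set_gf path_graph_def)
qed

text \<open>Excluding the end vertex makes its only possible edge harmless. This is what shortens
  the path from \<open>h - 2\<close> to \<open>h - 3\<close> vertices when a neighbour of its end is
  selected.\<close>

lemma path_indep_snoc:
  assumes "z \<notin> set xs"
  shows "A \<in> path_indep (xs @ [z]) \<and> z \<notin> A \<longleftrightarrow> A \<in> path_indep xs"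
proof (cases xs rule: rev_cases)
  case Nil
  then show ?thesis by (auto simp: path_indep_def)
next
  case (snoc ys y)
  then show ?thesis using assms by (auto simp: path_indep_def)
qed

lemma path_indep_Cons:
  assumes "z \<notin> set xs"
  shows "A \<in> path_indep (z # xs) \<and> z \<notin> A \<longleftrightarrow> A \<in> path_indep xs"
proof (cases xs)
  case Nil
  then show ?thesis by (auto simp: path_indep_def)
next
  case (Cons y ys)
  then show ?thesis using assms by (auto simp: path_indep_def)
qed

lemma path_connected:
  assumes "path_edges xs \<subseteq> edges G" "u \<in> set xs" "v \<in> set xs"
  shows "(u, v) \<in> (adj G)\<^sup>*"
proof -
  \<comment> \<open>Both directions are proved together, so that any two vertices can be joined
    through the head of the list.\<close>
  have "(hd xs, v) \<in> (adj G)\<^sup>* \<and> (v, hd xs) \<in> (adj G)\<^sup>*" if "v \<in> set xs" for v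
    using assms(1) that
  proof (induction xs arbitrary: v)
    case (Cons x xs)
    show ?case
    proof (cases "v = x")
      case False
      then obtain y ys where xs: "xs = y # ys" and v: "v \<in> set xs"
        using Cons.prems by (cases xs) auto
      have "(x, y) \<in> adj G" "(y, x) \<in> adj G"
        using Cons.prems xs by (auto simp: adj_def insert_commute)
      moreover have "(y, v) \<in> (adj G)\<^sup>* \<and> (v, y) \<in> (adj G)\<^sup>*"
        using Cons.IH[OF _ v] Cons.prems xs by simp
      ultimately show ?thesis by (auto intro: converse_rtrancl_into_rtrancl rtrancl_into_rtrancl)
    qed simp
  qed simp
  then show ?thesis using assms(2,3) by (meson rtrancl_trans)
qed

section \<open>Cycles as closed walks\<close>

lemma cycle_edges_Cons:
  "{{(x # xs) ! i, (x # xs) ! (Suc i mod length (x # xs))} | i. i < length (x # xs)}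
   = path_edges (x # xs @ [x])"
proof -
  have eq: "(x # xs) ! i = (x # xs @ [x]) ! i \<and>
      (x # xs) ! (Suc i mod length (x # xs)) = (x # xs @ [x]) ! Suc i"
    if "i < length (x # xs)" for i
  \<comment> \<open>Only at the last index does the remainder wrap around to 0; there the closed
    walk has its repeated entry \<open>x\<close>.\<close>
  proof (cases "i = length xs")
    case True
    then show ?thesis by (simp add: nth_append nth_Cons')
  next
    case False
    then show ?thesis using that by (auto simp: nth_append nth_Cons')
  qed
  have "(\<lambda>i. {(x # xs) ! i, (x # xs) ! (Suc i mod length (x # xs))}) ` {i. i < length (x # xs)}
      = (\<lambda>i. {(x # xs @ [x]) ! i, (x # xs @ [x]) ! Suc i}) ` {i. i < length (x # xs)}"
    by (intro image_cong refl) (metis eq mem_Collect_eq)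
  moreover have "{i. i < length (x # xs)} = {i. Suc i < length (x # xs @ [x])}" by simp
  ultimately show ?thesis unfolding path_edges_def setcompr_eq_image by argo
qed

text \<open>The closed walk is cut at \<open>u\<close>; the two arcs between its old starting vertex
  and \<open>u\<close> give the same edges in either order.\<close>

lemma cycle_graph_rotate:
  assumes "cycle_graph C" "u \<in> verts C"
  obtains xs where "distinct (u # xs)" "2 \<le> length xs" "verts C = set (u # xs)"
    "edges C = path_edges (u # xs @ [u])"
proof -
  obtain vs where vs: "distinct vs" "3 \<le> length vs" "verts C = set vs"
    and E: "edges C = {{vs ! i, vs ! (Suc i mod length vs)} | i. i < length vs}"
    using assms(1) unfolding cycle_graph_def by blast
  then obtain ys zs where split: "vs = ys @ u # zs" using assms(2) by (metis split_list)
  have "edges C = path_edges (u # (zs @ ys) @ [u])"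
  proof (cases ys)
    case Nil
    then show ?thesis using E cycle_edges_Cons[of u zs] split by simp
  next
    case (Cons y ys')
    then have "edges C = path_edges (y # ys' @ u # zs @ [y])"
      using E cycle_edges_Cons[of y "ys' @ u # zs"] split by simp
    also have "\<dots> = path_edges (y # ys' @ [u]) \<union> path_edges (u # zs @ [y])"
      using path_edges_append[of "y # ys'" u "zs @ [y]"] by simp
    also have "\<dots> = path_edges (u # (zs @ ys) @ [u])"
      using path_edges_append[of "u # zs" y "ys' @ [u]"] Cons by auto
    finally show ?thesis .
  qed
  then show thesis using that[of "zs @ ys"] vs split by auto
qed

text \<open>After rotation to \<open>u\<close>, only the first and the last of the other vertices
  are joined to \<open>u\<close>, so \<open>v\<close> is one of them; if it is the last, the list is
  reversed.\<close>

lemma cycle_graph_edge: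
  assumes C: "cycle_graph C" and e: "{u, v} \<in> edges C"
  obtains xs where "distinct (u # v # xs)" "xs \<noteq> []" "verts C = set (u # v # xs)"
    "edges C = insert {u, v} (path_edges (v # xs @ [u]))"
proof -
  have "u \<in> verts C"
  proof -
    obtain vs where vs: "3 \<le> length vs" "verts C = set vs"
      "edges C = {{vs ! i, vs ! (Suc i mod length vs)} | i. i < length vs}"
      using C unfolding cycle_graph_def by blast
    then obtain i where i: "i < length vs" "{u, v} = {vs ! i, vs ! (Suc i mod length vs)}"
      using e by blast
    have "0 < length vs" using vs(1) by linarith
    then have "Suc i mod length vs < length vs" by simp
    then show ?thesis using i vs(2) by (metis insertI1 insertE nth_mem singletonD)
  qed
  then obtain ys where ys: "distinct (u # ys)" "2 \<le> length ys" "verts C = set (u # ys)"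
    "edges C = path_edges (u # ys @ [u])"
    using cycle_graph_rotate[OF C] by metis
  obtain y zs z where split: "ys = y # zs @ [z]"
    using ys(2) by (cases ys; cases "tl ys" rule: rev_cases) auto
  have E: "edges C = insert {u, y} (insert {z, u} (path_edges (y # zs @ [z])))"
    using ys(4) path_edges_snoc[of "y # zs" z u] by (simp add: split)
  have "{u, v} \<notin> path_edges (y # zs @ [z])"
    using path_edges_subset[of "{u, v}" "y # zs @ [z]"] ys(1) split by auto
  then consider "v = y" | "v = z" using e E ys(1) split by (auto simp: doubleton_eq_iff)
  then show thesis
  proof cases
    case 1
    then show thesis using that[of "zs @ [z]"] ys split by auto
  next
    case 2
    have "path_edges (v # rev (y # zs) @ [u]) = path_edges (u # y # zs @ [z])"
      using path_edges_rev[of "u # y # zs @ [z]"] 2 by simp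
    then have "edges C = insert {u, v} (path_edges (v # rev (y # zs) @ [u]))"
      unfolding E using 2 by (auto simp: insert_commute)
    then show thesis using that[of "rev (y # zs)"] ys split 2 by auto
  qed
qed

lemma cycle_edge_subset:
  assumes "cycle_graph C" "e \<in> edges C"
  shows "e \<subseteq> verts C"
proof -
  obtain vs where "3 \<le> length vs" "verts C = set vs"
    "edges C = {{vs ! i, vs ! (Suc i mod length vs)} | i. i < length vs}"
    using assms(1) unfolding cycle_graph_def by blast
  moreover from this(1) have "0 < length vs" by linarith
  ultimately show ?thesis using assms(2) by (auto intro!: nth_mem mod_less_divisor)
qed

lemma cycle_neighbour:
  assumes "cycle_graph C" "u \<in> verts C"
  obtains v where "{u, v} \<in> edges C"
proof -
  obtain xs where "2 \<le> length xs" "edges C = path_edges (u # xs @ [u])"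
    using cycle_graph_rotate[OF assms] by metis
  then show thesis using that[of "hd xs"] by (cases xs) auto
qed

lemma cycle_connected:
  assumes "cycle_graph C" "u \<in> verts C" "v \<in> verts C"
  shows "(u, v) \<in> (adj C)\<^sup>*"
proof -
  obtain xs where "verts C = set (u # xs)" "edges C = path_edges (u # xs @ [u])"
    using cycle_graph_rotate[OF assms(1,2)] by metis
  then show ?thesis using path_connected[of "u # xs @ [u]" C u v] assms(3) by auto
qed

text \<open>A cycle minus one of its vertices is a path, and a cycle not containing \<open>x\<close>
  is untouched. The deletion takes place in the larger graph \<open>G\<close>, since cut vertices of
  a whole chain will be deleted.\<close>

lemma cycle_del_vertex_connected:
  assumes C: "cycle_graph C" and sub: "edges C \<subseteq> edges G"
    and u: "u \<in> verts C - {x}" and v: "v \<in> verts C - {x}"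
  shows "(u, v) \<in> (adj (del_vertex G x))\<^sup>*"
proof -
  have "\<exists>ys. set ys = verts C - {x} \<and> path_edges ys \<subseteq> edges C \<and> x \<notin> set ys"
  proof (cases "x \<in> verts C")
    case True
    then obtain xs where xs: "distinct (x # xs)" "2 \<le> length xs" "verts C = set (x # xs)"
      "edges C = path_edges (x # xs @ [x])"
      using cycle_graph_rotate[OF C] by metis
    obtain ys y where split: "xs = ys @ [y]" using xs(2) by (cases xs rule: rev_cases) auto
    have "path_edges (x # xs) \<subseteq> edges C"
      using xs(4) path_edges_snoc[of "x # ys" y x] by (auto simp: split)
    moreover have "path_edges xs \<subseteq> path_edges (x # xs)" by (cases xs) auto
    ultimately have "path_edges xs \<subseteq> edges C" by blast
    then show ?thesis using xs by (intro exI[of _ xs]) auto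
  next
    case False
    obtain xs where "verts C = set (u # xs)" "edges C = path_edges (u # xs @ [u])"
      using cycle_graph_rotate[OF C, of u] u by (metis DiffD1)
    then show ?thesis using False by (intro exI[of _ "u # xs @ [u]"]) auto
  qed
  then obtain ys where ys: "set ys = verts C - {x}" "path_edges ys \<subseteq> edges C" "x \<notin> set ys"
    by blast
  then have "path_edges ys \<subseteq> edges (del_vertex G x)"
    using sub path_edges_subset[of _ ys] unfolding del_vertex_def by fastforce
  then show ?thesis using path_connected u v ys(1) by metis
qed

section \<open>Gluing a cycle at a vertex\<close>

definition graph_union :: "'a ugraph \<Rightarrow> 'a ugraph \<Rightarrow> 'a ugraph" where
  "graph_union H C = \<lparr>verts = verts H \<union> verts C, edges = edges H \<union> edges C\<rparr>"

definition gf_avoid :: "'a ugraph \<Rightarrow> 'a \<Rightarrow> int poly" where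
  "gf_avoid G v = set_gf {S. indep_set G S \<and> v \<notin> S}"

definition gf_contain :: "'a ugraph \<Rightarrow> 'a \<Rightarrow> int poly" where
  "gf_contain G v = set_gf {S. indep_set G S \<and> v \<in> S}"

lemma indep_poly_split:
  assumes "finite (verts G)"
  shows "indep_poly G = gf_avoid G v + gf_contain G v"
proof -
  have "{S. indep_set G S} = {S. indep_set G S \<and> v \<notin> S} \<union> {S. indep_set G S \<and> v \<in> S}" by blast
  moreover have "finite {S. indep_set G S \<and> v \<notin> S}" "finite {S. indep_set G S \<and> v \<in> S}"
    using finite_subset[OF _ finite_indep_sets[OF assms]] by (simp_all add: Collect_mono)
  ultimately show ?thesis
    unfolding indep_poly_eq_set_gf[OF assms] gf_avoid_def gf_contain_def
    by (metis (mono_tags, lifting) set_gf_Un_disjoint disjoint_iff mem_Collect_eq)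
qed

text \<open>Apart from \<open>path_edges xs\<close>, the edges of \<open>C\<close> are those from
  \<open>w\<close> to \<open>w'\<close>, from \<open>w'\<close> to \<open>hd xs\<close> and from
  \<open>last xs\<close> to \<open>w\<close>. In a triangle \<open>hd xs\<close> and
  \<open>last xs\<close> coincide.\<close>

lemma indep_set_graph_union_cycle:
  assumes H: "\<And>e. e \<in> edges H \<Longrightarrow> e \<subseteq> verts H" and w: "w \<in> verts H"
    and disj: "verts H \<inter> set (w' # xs) = {}" and xs: "distinct (w' # xs)" "xs \<noteq> []"
    and C: "verts C = set (w # w' # xs)" "edges C = insert {w, w'} (path_edges (w' # xs @ [w]))"
  shows "indep_set (graph_union H C) S \<longleftrightarrow>
    S \<subseteq> verts H \<union> set (w' # xs) \<and> indep_set H (S \<inter> verts H) \<and> S \<inter> set xs \<in> path_indep xs \<and>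
    \<not> (w \<in> S \<and> w' \<in> S) \<and> \<not> (w' \<in> S \<and> hd xs \<in> S) \<and> \<not> (w \<in> S \<and> last xs \<in> S)"
proof -
  obtain ys z where snoc: "xs = ys @ [z]" using xs(2) by (cases xs rule: rev_cases) auto
  obtain y zs where cons: "xs = y # zs" using xs(2) by (cases xs) auto
  have "path_edges (w' # xs @ [w]) = insert {w', y} (path_edges (xs @ [w]))"
    by (simp add: cons)
  also have "path_edges (xs @ [w]) = insert {z, w} (path_edges xs)"
    by (simp add: snoc)
  finally have "edges C = insert {w, w'} (insert {w', hd xs} (insert {last xs, w} (path_edges xs)))"
    unfolding C(2) using snoc cons by (metis last_snoc list.sel(1))
  then have "(\<forall>e\<in>edges C. \<not> e \<subseteq> S) \<longleftrightarrow> (\<forall>e\<in>path_edges xs. \<not> e \<subseteq> S) \<and>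
      \<not> (w \<in> S \<and> w' \<in> S) \<and> \<not> (w' \<in> S \<and> hd xs \<in> S) \<and> \<not> (w \<in> S \<and> last xs \<in> S)"
    by auto
  moreover have "(\<forall>e\<in>edges H. \<not> e \<subseteq> S \<inter> verts H) \<longleftrightarrow> (\<forall>e\<in>edges H. \<not> e \<subseteq> S)"
    by (metis H le_inf_iff)
  moreover have "(\<forall>e\<in>path_edges xs. \<not> e \<subseteq> S \<inter> set xs) \<longleftrightarrow> (\<forall>e\<in>path_edges xs. \<not> e \<subseteq> S)"
    by (metis path_edges_subset le_inf_iff)
  moreover have "verts H \<union> verts C = verts H \<union> set (w' # xs)" using C(1) w by auto
  ultimately show ?thesis
    unfolding indep_set_def graph_union_def path_indep_def ugraph.simps ball_Un mem_Collect_eq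
    by (simp only: Int_lower2 simp_thms ugraph.simps)
qed

text \<open>Without \<open>w'\<close>, the path \<open>xs\<close> is unrestricted if
  \<open>w\<close> is absent and loses its last vertex if \<open>w\<close> is present. With
  \<open>w'\<close>, both \<open>w\<close> and \<open>hd xs\<close> are excluded, and
  \<open>w'\<close> itself contributes the factor x.\<close>

lemma gf_graph_union_cycle:
  assumes fin: "finite (verts H)"
    and H: "\<And>e. e \<in> edges H \<Longrightarrow> e \<subseteq> verts H" and w: "w \<in> verts H"
    and C: "cycle_graph C" "card (verts C) = h" and e: "{w, w'} \<in> edges C"
    and inter: "verts H \<inter> verts C = {w}"
  shows "gf_avoid (graph_union H C) w' =
      gf_avoid H w * indep_poly (path_graph (h - 2)) + gf_contain H w * indep_poly (path_graph (h - 3))"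
    and "gf_contain (graph_union H C) w' =
      monom 1 1 * gf_avoid H w * indep_poly (path_graph (h - 3))"
proof -
  obtain xs where xs: "distinct (w # w' # xs)" "xs \<noteq> []"
    and vC: "verts C = set (w # w' # xs)" and eC: "edges C = insert {w, w'} (path_edges (w' # xs @ [w]))"
    using cycle_graph_edge[OF C(1) e] by metis
  have d: "distinct (w' # xs)" and disj: "verts H \<inter> set (w' # xs) = {}"
    using xs(1) inter vC by auto
  note iff = indep_set_graph_union_cycle[OF H w disj d xs(2) vC eC]
  obtain ys z where snoc: "xs = ys @ [z]" using xs(2) by (cases xs rule: rev_cases) auto
  obtain y zs where cons: "xs = y # zs" using xs(2) by (cases xs) auto
  have h: "h = length xs + 2" using C(2) vC xs(1) by (simp add: distinct_card)
  let ?A = "{S. indep_set H S \<and> w \<notin> S}" and ?B = "{S. indep_set H S \<and> w \<in> S}"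
  have sub: "?A \<subseteq> Pow (verts H)" "?B \<subseteq> Pow (verts H)" by (auto simp: indep_set_def)
  have dx: "verts H \<inter> set xs = {}" using disj by auto
  have wxs: "w \<notin> set xs" "w' \<notin> verts H" "w' \<notin> set xs" using xs disj by auto
  have gf_xs: "set_gf (path_indep xs) = indep_poly (path_graph (h - 2))"
    using set_gf_path_indep[of xs] d h by simp
  have gf_ys: "set_gf (path_indep ys) = indep_poly (path_graph (h - 3))"
    using set_gf_path_indep[of ys] d h snoc by simp
  have gf_zs: "set_gf (path_indep zs) = indep_poly (path_graph (h - 3))"
    using set_gf_path_indep[of zs] d h cons by simp

  \<comment> \<open>\<open>?P\<close> and \<open>?Q\<close> separate the independent sets avoiding
    \<open>w'\<close> by whether they contain \<open>w\<close>.\<close>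
  let ?P = "{S. S \<subseteq> verts H \<union> set xs \<and> S \<inter> verts H \<in> ?A \<and> S \<inter> set xs \<in> path_indep xs}"
  let ?Q = "{S. S \<subseteq> verts H \<union> set xs \<and> S \<inter> verts H \<in> ?B \<and> S \<inter> set xs \<in> path_indep ys}"
  have ysx: "path_indep ys \<subseteq> Pow (set xs)" using path_indep_subset[of ys] snoc by auto
  have P: "set_gf ?P = gf_avoid H w * indep_poly (path_graph (h - 2))"
    unfolding gf_avoid_def gf_xs[symmetric]
    by (rule set_gf_product[OF fin _ dx sub(1) path_indep_subset]) simp
  have Q: "set_gf ?Q = gf_contain H w * indep_poly (path_graph (h - 3))"
    unfolding gf_contain_def gf_ys[symmetric]
    by (rule set_gf_product[OF fin _ dx sub(2) ysx]) simp
  have ys: "A \<in> path_indep ys \<longleftrightarrow> A \<in> path_indep xs \<and> z \<notin> A" for A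
    using path_indep_snoc[of z ys A] d snoc by auto
  have zs: "A \<in> path_indep zs \<longleftrightarrow> A \<in> path_indep xs \<and> y \<notin> A" for A
    using path_indep_Cons[of y zs A] d cons by auto
  have "{S. indep_set (graph_union H C) S \<and> w' \<notin> S} = ?P \<union> ?Q"
  proof (rule set_eqI)
    fix S
    have "last xs = z" "z \<in> set xs" by (simp_all add: snoc)
    then show "S \<in> {S. indep_set (graph_union H C) S \<and> w' \<notin> S} \<longleftrightarrow> S \<in> ?P \<union> ?Q"
      using w wxs by (simp add: iff ys) blast
  qed
  moreover have "finite ?P" "finite ?Q"
    by (rule finite_subset[of _ "Pow (verts H \<union> set xs)"]; use fin in auto)+
  moreover have "?P \<inter> ?Q = {}" by auto
  ultimately show "gf_avoid (graph_union H C) w' =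
      gf_avoid H w * indep_poly (path_graph (h - 2)) + gf_contain H w * indep_poly (path_graph (h - 3))"
    unfolding gf_avoid_def[of "graph_union H C"] P[symmetric] Q[symmetric]
    by (simp only: set_gf_Un_disjoint)

  have zsx: "path_indep zs \<subseteq> Pow (set xs)" using path_indep_subset[of zs] cons by auto
  then have insx: "insert w' ` path_indep zs \<subseteq> Pow (set (w' # xs))" by auto
  \<comment> \<open>The vertex \<open>w'\<close> is built into the second factor. It excludes
    \<open>w\<close>, which selects \<open>?A\<close> and makes the edge between
    \<open>last xs\<close> and \<open>w\<close> harmless.\<close>
  have "{S. indep_set (graph_union H C) S \<and> w' \<in> S} =
    {S. S \<subseteq> verts H \<union> set (w' # xs) \<and> S \<inter> verts H \<in> ?A
      \<and> S \<inter> set (w' # xs) \<in> insert w' ` path_indep zs}"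
  proof (rule set_eqI)
    fix S
    have img: "S \<inter> set (w' # xs) \<in> insert w' ` path_indep zs \<longleftrightarrow>
        w' \<in> S \<and> S \<inter> set xs \<in> path_indep zs" (is "?L \<longleftrightarrow> ?R")
    proof
      assume ?L
      then obtain A where A: "A \<in> path_indep zs" "S \<inter> set (w' # xs) = insert w' A" by blast
      then have "A \<subseteq> set xs" using zsx by blast
      then have "S \<inter> set xs = A" using A(2) wxs(3) by auto
      then show ?R using A by auto
    next
      assume R: ?R
      then have "S \<inter> set (w' # xs) = insert w' (S \<inter> set xs)" by auto
      then show ?L using R by blast
    qed
    have "hd xs = y" "y \<in> set xs" by (simp_all add: cons)
    then show "S \<in> {S. indep_set (graph_union H C) S \<and> w' \<in> S} \<longleftrightarrow>
      S \<in> {S. S \<subseteq> verts H \<union> set (w' # xs) \<and> S \<inter> verts H \<in> ?A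
        \<and> S \<inter> set (w' # xs) \<in> insert w' ` path_indep zs}"
      unfolding mem_Collect_eq img using w wxs by (simp add: iff zs) blast
  qed
  moreover have "set_gf \<dots> = set_gf ?A * set_gf (insert w' ` path_indep zs)"
    by (rule set_gf_product[OF fin _ disj sub(1) insx]) simp
  moreover have "set_gf (insert w' ` path_indep zs) = monom 1 1 * set_gf (path_indep zs)"
    by (rule set_gf_insert_image[OF _ wxs(3) zsx]) simp
  ultimately show "gf_contain (graph_union H C) w' =
      monom 1 1 * gf_avoid H w * indep_poly (path_graph (h - 3))"
    by (simp add: gf_contain_def gf_avoid_def gf_zs mult_ac)
qed

section \<open>The two-state recursion along the chain\<close>

text \<open>The start value is that of a single vertex: the first cycle is glued to it like all others.\<close>

fun chain_gf :: "nat \<Rightarrow> nat \<Rightarrow> int poly \<times> int poly" where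
  "chain_gf h 0 = (1, monom 1 1)"
| "chain_gf h (Suc m) = (case chain_gf h m of (r, s) \<Rightarrow>
     (r * indep_poly (path_graph (h - 2)) + s * indep_poly (path_graph (h - 3)),
      monom 1 1 * r * indep_poly (path_graph (h - 3))))"

text \<open>With p and q the polynomials of the paths on \<open>h - 2\<close> and
  \<open>h - 3\<close> vertices, one step multiplies by the matrix with rows (p, q) and (x q, 0), of
  trace p and determinant -x q^2. The recurrence is its Cayley-Hamilton equation, summed over both
  components.\<close>

lemma chain_gf_recurrence:
  fixes h m :: nat
  defines "A \<equiv> \<lambda>m. fst (chain_gf h m) + snd (chain_gf h m)"
  shows "A (Suc (Suc m)) = monom 1 1 * (indep_poly (path_graph (h - 3)))\<^sup>2 * A m
    + indep_poly (path_graph (h - 2)) * A (Suc m)"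
proof -
  define x :: "int poly" where "x = monom 1 1"
  define p q where "p = indep_poly (path_graph (h - 2))" and "q = indep_poly (path_graph (h - 3))"
  obtain r s where rs: "chain_gf h m = (r, s)" by (cases "chain_gf h m")
  have "chain_gf h (Suc m) = (r * p + s * q, x * r * q)"
    using rs by (simp add: p_def q_def x_def)
  moreover from this have
    "chain_gf h (Suc (Suc m)) = ((r * p + s * q) * p + x * r * q * q, x * (r * p + s * q) * q)"
    by (simp add: p_def q_def x_def)
  ultimately show ?thesis
    unfolding A_def p_def[symmetric] q_def[symmetric] x_def[symmetric] rs
    by (simp add: algebra_simps power2_eq_square)
qed

text \<open>The extra vertex \<open>a\<close> makes the empty prefix a one-vertex graph, to which
  the first cycle can be glued.\<close>

definition chain_prefix :: "'a \<Rightarrow> 'a ugraph list \<Rightarrow> nat \<Rightarrow> 'a ugraph" where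
  "chain_prefix a Cs k =
     \<lparr>verts = insert a (\<Union>j<k. verts (Cs ! j)), edges = (\<Union>j<k. edges (Cs ! j))\<rparr>"

text \<open>Cycle \<open>k\<close> is glued at \<open>w k\<close>, and its neighbour
  \<open>w (Suc k)\<close> in that cycle is where the next one goes. The vertex \<open>w 0\<close>
  has a hypothesis of its own because every prefix contains it explicitly.\<close>

lemma gf_chain_prefix:
  fixes w :: "nat \<Rightarrow> 'a"
  assumes C: "\<And>k. k < length Cs \<Longrightarrow> cycle_graph (Cs ! k) \<and> card (verts (Cs ! k)) = h"
    and e: "\<And>k. k < length Cs \<Longrightarrow> {w k, w (Suc k)} \<in> edges (Cs ! k)"
    and inter: "\<And>j k. j < k \<Longrightarrow> k < length Cs \<Longrightarrow> verts (Cs ! j) \<inter> verts (Cs ! k) \<subseteq> {w k}"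
    and w0: "\<And>k. 0 < k \<Longrightarrow> k < length Cs \<Longrightarrow> w 0 \<notin> verts (Cs ! k)"
  shows "k \<le> length Cs \<Longrightarrow>
    (gf_avoid (chain_prefix (w 0) Cs k) (w k), gf_contain (chain_prefix (w 0) Cs k) (w k)) = chain_gf h k"
proof (induction k)
  case 0
  have "{S. indep_set (chain_prefix (w 0) Cs 0) S \<and> w 0 \<notin> S} = {{}}"
    "{S. indep_set (chain_prefix (w 0) Cs 0) S \<and> w 0 \<in> S} = {{w 0}}"
    by (auto simp: indep_set_def chain_prefix_def)
  then show ?case by (simp add: gf_avoid_def gf_contain_def set_gf_def one_pCons monom_0)
next
  case (Suc k)
  let ?H = "chain_prefix (w 0) Cs k" and ?C = "Cs ! k"
  have k: "k < length Cs" using Suc.prems by simp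
  have Ck: "cycle_graph ?C" "card (verts ?C) = h" using C[OF k] by auto
  have fin: "finite (verts ?H)"
  proof -
    have "finite (verts (Cs ! j))" if "j < k" for j
      using C[of j] that k by (auto simp: cycle_graph_def)
    then show ?thesis by (simp add: chain_prefix_def)
  qed
  have H: "e \<subseteq> verts ?H" if eH: "e \<in> edges ?H" for e
  proof -
    obtain j where j: "j < k" "e \<in> edges (Cs ! j)" using eH by (auto simp: chain_prefix_def)
    then have "e \<subseteq> verts (Cs ! j)" using cycle_edge_subset C[of j] k by auto
    then show ?thesis using j(1) by (auto simp: chain_prefix_def)
  qed
  have wC: "w k \<in> verts ?C" using cycle_edge_subset[OF Ck(1) e[OF k]] by simp
  have w: "w k \<in> verts ?H"
  proof (cases k)
    case (Suc j)
    then have "w k \<in> verts (Cs ! j)" using cycle_edge_subset[OF _ e[of j]] C[of j] k by simp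
    then show ?thesis using Suc by (auto simp: chain_prefix_def)
  qed (simp add: chain_prefix_def)
  have "verts ?H \<inter> verts ?C \<subseteq> {w k}"
    using inter[of _ k] w0[of k] k by (cases "k = 0") (auto simp: chain_prefix_def)
  then have int: "verts ?H \<inter> verts ?C = {w k}" using w wC by auto
  have un: "chain_prefix (w 0) Cs (Suc k) = graph_union ?H ?C"
    by (auto simp: chain_prefix_def graph_union_def lessThan_Suc)
  note step = gf_graph_union_cycle[OF fin H w Ck e[OF k] int]
  have IH: "chain_gf h k = (gf_avoid ?H (w k), gf_contain ?H (w k))" using Suc by simp
  show ?case unfolding un by (simp add: step IH)
qed

section \<open>Structure of ortho-chains\<close>

lemma subgraph_connected_extends_to_block:
  assumes G: "finite (verts G)" "finite (edges G)"
    and B0: "subgraph B0 G" "graph_connected B0" "\<nexists>v. cut_vertex B0 v"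
  obtains B where "block G B" "subgraph B0 B"
proof -
  let ?P = "\<lambda>B. subgraph B G \<and> graph_connected B \<and> (\<nexists>v. cut_vertex B v) \<and> subgraph B0 B"
  \<comment> \<open>A candidate with the most vertices and edges is maximal under inclusion, since
    in a finite graph a proper extension would increase this number.\<close>
  let ?f = "\<lambda>B. card (verts B) + card (edges B)"
  have "?P B0" using B0 by (auto simp: subgraph_def)
  moreover have "\<forall>B. ?P B \<longrightarrow> ?f B < Suc (?f G)"
    using G by (auto simp: subgraph_def less_Suc_eq_le intro!: add_mono card_mono)
  ultimately obtain B where B: "?P B" and max: "\<And>B'. ?P B' \<Longrightarrow> ?f B' \<le> ?f B"
    using ex_has_greatest_nat[of ?P B0 ?f "Suc (?f G)"] by (metis less_imp_le)
  have "B' = B" if B': "subgraph B' G" "graph_connected B'" "\<nexists>v. cut_vertex B' v" "subgraph B B'" for B'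
  proof -
    have sub: "verts B \<subseteq> verts B'" "edges B \<subseteq> edges B'" using B'(4) by (auto simp: subgraph_def)
    have fin: "finite (verts B')" "finite (edges B')"
      using B'(1) G by (auto simp: subgraph_def intro: finite_subset)
    have "subgraph B0 B'" using B B'(4) by (auto simp: subgraph_def)
    then have "?f B' \<le> ?f B" using max B' by blast
    moreover have "card (verts B) \<le> card (verts B')" "card (edges B) \<le> card (edges B')"
      using sub fin by (auto intro: card_mono)
    ultimately have "card (verts B) = card (verts B')" "card (edges B) = card (edges B')" by linarith+
    then have "verts B = verts B'" "edges B = edges B'" 
      using card_subset_eq[OF fin(1) sub(1)] card_subset_eq[OF fin(2) sub(2)] by blast+
    then show ?thesis by simp
  qed
  then have "block G B" using B unfolding block_def by blast
  then show thesis using that B by blast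
qed

lemma chain_cactus_simple: "chain_cactus G \<Longrightarrow> simple_graph G"
  by (simp add: chain_cactus_def cactus_def)

lemma simple_graph_finite_edges: "simple_graph G \<Longrightarrow> finite (edges G)"
  by (rule finite_subset[of _ "Pow (verts G)"]) (auto simp: simple_graph_def)

text \<open>The block extending \<open>B\<close> is a cycle. Applied to single vertices and single
  edges, this shows that the cycles cover the graph.\<close>

lemma chain_cactus_covered:
  assumes G: "chain_cactus G" and B: "subgraph B G" "graph_connected B" "\<nexists>v. cut_vertex B v"
  obtains C where "C \<in> cycles G" "verts B \<subseteq> verts C" "edges B \<subseteq> edges C"
proof -
  have "finite (verts G)" "finite (edges G)"
    using chain_cactus_simple[OF G] simple_graph_finite_edges by (auto simp: simple_graph_def)
  then obtain C where C: "block G C" "subgraph B C"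
    using subgraph_connected_extends_to_block B by metis
  then have "cycle_graph C" "subgraph C G" using G by (auto simp: chain_cactus_def block_def)
  then show thesis using that C(2) by (auto simp: cycles_def subgraph_def)
qed

lemma chain_cactus_verts:
  assumes G: "chain_cactus G"
  shows "verts G = (\<Union>C\<in>cycles G. verts C)"
proof
  show "verts G \<subseteq> (\<Union>C\<in>cycles G. verts C)"
  proof
    fix v assume v: "v \<in> verts G"
    define B where "B = \<lparr>verts = {v}, edges = {} :: 'a set set\<rparr>"
    have "subgraph B G" "graph_connected B" "\<nexists>v. cut_vertex B v"
      using v by (auto simp: B_def subgraph_def simple_graph_def graph_connected_def cut_vertex_def)
    then obtain C where "C \<in> cycles G" "verts B \<subseteq> verts C" using chain_cactus_covered[OF G] by metis
    then show "v \<in> (\<Union>C\<in>cycles G. verts C)" by (auto simp: B_def)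
  qed
qed (auto simp: cycles_def subgraph_def)

lemma chain_cactus_edges:
  assumes G: "chain_cactus G"
  shows "edges G = (\<Union>C\<in>cycles G. edges C)"
proof
  show "edges G \<subseteq> (\<Union>C\<in>cycles G. edges C)"
  proof
    fix e assume e: "e \<in> edges G"
    then have "e \<subseteq> verts G" "card e = 2"
      using chain_cactus_simple[OF G] by (auto simp: simple_graph_def)
    then obtain a b where ab: "e = {a, b}" "a \<noteq> b" by (auto simp: card_2_iff)
    define B where "B = \<lparr>verts = {a, b}, edges = {e}\<rparr>"
    have adjB: "(a, b) \<in> adj B" "(b, a) \<in> adj B" by (auto simp: adj_def B_def ab)
    have "subgraph B G" using e ab \<open>e \<subseteq> verts G\<close> by (auto simp: B_def subgraph_def simple_graph_def)
    moreover have "graph_connected B" using adjB by (auto simp: graph_connected_def B_def)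
    \<comment> \<open>Only one vertex remains beside \<open>v\<close>, and it reaches itself in zero
      steps, so nothing gets separated.\<close>
    moreover have "\<nexists>v. cut_vertex B v" by (auto simp: cut_vertex_def B_def)
    ultimately obtain C where "C \<in> cycles G" "edges B \<subseteq> edges C"
      using chain_cactus_covered[OF G] by metis
    then show "e \<in> (\<Union>C\<in>cycles G. edges C)" by (auto simp: B_def)
  qed
qed (auto simp: cycles_def subgraph_def)

section \<open>Intersections of the cycles along the chain\<close>

lemma shared_cut_vertex_cycles:
  assumes "chain_cactus G" "cut_vertex G v" "C \<in> cycles G" "D \<in> cycles G" "C \<noteq> D"
    "v \<in> verts C" "v \<in> verts D"
  shows "{C \<in> cycles G. v \<in> verts C} = {C, D}"
proof -
  have "card {C \<in> cycles G. v \<in> verts C} = 2" using assms(1,2) by (simp add: chain_cactus_def)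
  \<comment> \<open>Infinite sets have \<open>card\<close> 0, so cardinality 2 forces
    finiteness.\<close>
  moreover from this have "finite {C \<in> cycles G. v \<in> verts C}" by (metis card.infinite zero_neq_numeral)
  moreover have "{C, D} \<subseteq> {C \<in> cycles G. v \<in> verts C}" using assms by auto
  ultimately show ?thesis using card_subset_eq[of _ "{C, D}"] assms(5) by (metis card_2_iff)
qed

text \<open>A cut vertex lies in only two cycles, here those at \<open>i\<close> and
  \<open>Suc i\<close>; distinctness of \<open>Cs\<close> turns equal cycles into equal
  indices.\<close>

lemma chain_order_cut_vertex_index:
  assumes G: "chain_cactus G" and order: "chain_order G Cs"
    and v: "cut_vertex G v" "v \<in> verts (Cs ! i) \<inter> verts (Cs ! Suc i)" and i: "Suc i < length Cs"
    and k: "k < length Cs" "v \<in> verts (Cs ! k)"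
  shows "k = i \<or> k = Suc i"
proof -
  have d: "distinct Cs" and cyc: "\<And>k. k < length Cs \<Longrightarrow> Cs ! k \<in> cycles G"
    using order nth_mem[of _ Cs] by (auto simp: chain_order_def)
  have i': "i < length Cs" using i by simp
  have "Cs ! i \<noteq> Cs ! Suc i" using nth_eq_iff_index_eq[OF d i' i] by simp
  then have "{C \<in> cycles G. v \<in> verts C} = {Cs ! i, Cs ! Suc i}"
    using shared_cut_vertex_cycles[OF G v(1) cyc[OF i'] cyc[OF i]] v(2) by blast
  then have "Cs ! k \<in> {Cs ! i, Cs ! Suc i}" using cyc[OF k(1)] k(2) by blast
  then show ?thesis
    using nth_eq_iff_index_eq[OF d k(1) i'] nth_eq_iff_index_eq[OF d k(1) i] by auto
qed

text \<open>If two cycles on different sides of the cut vertex \<open>v i\<close> met elsewhere, then all the cycles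
  would stay linked to each other after deleting \<open>v i\<close>.\<close>

lemma chain_order_inter:
  assumes G: "chain_cactus G" and order: "chain_order G Cs"
    and v: "\<And>i. Suc i < length Cs \<Longrightarrow> cut_vertex G (v i) \<and> verts (Cs ! i) \<inter> verts (Cs ! Suc i) = {v i}"
    and ab: "a \<le> i" "i < b" "b < length Cs"
  shows "verts (Cs ! a) \<inter> verts (Cs ! b) \<subseteq> {v i}"
proof (rule ccontr)
  let ?n = "length Cs" and ?R = "(adj (del_vertex G (v i)))\<^sup>*"
  assume "\<not> verts (Cs ! a) \<inter> verts (Cs ! b) \<subseteq> {v i}"
  then obtain w where wa: "w \<in> verts (Cs ! a)" and wb: "w \<in> verts (Cs ! b)" and wv: "w \<noteq> v i" by blast
  have cyc: "Cs ! k \<in> cycles G" if "k < ?n" for k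
    using order that nth_mem by (fastforce simp: chain_order_def)
  have symR: "(y, x) \<in> ?R" if "(x, y) \<in> ?R" for x y
  proof -
    have "sym (adj (del_vertex G (v i)))" by (auto simp: sym_def adj_def insert_commute)
    then show ?thesis using that by (meson sym_rtrancl symD)
  qed
  have conn: "(x, y) \<in> ?R" if "k < ?n" "x \<in> verts (Cs ! k) - {v i}" "y \<in> verts (Cs ! k) - {v i}" for k x y
    using cycle_del_vertex_connected[of "Cs ! k" G x "v i" y] cyc[OF that(1)] that(2,3)
    by (auto simp: cycles_def subgraph_def)
  \<comment> \<open>After deletion of \<open>v i\<close>, the vertex \<open>w\<close> still reaches
    all that remains of cycle \<open>k\<close>. Reaching one vertex of it suffices, because the
    remainder is connected.\<close>
  define P where "P k \<longleftrightarrow> (\<forall>x \<in> verts (Cs ! k) - {v i}. (w, x) \<in> ?R)" for k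
  have link: "P k" if "k < ?n" "x \<in> verts (Cs ! k) - {v i}" "(w, x) \<in> ?R" for k x
    unfolding P_def using conn[OF that(1,2)] that(3) by (blast intro: rtrancl_trans)
  have i: "i < ?n" "Suc i < ?n" using ab by auto
  have vi: "k = i \<or> k = Suc i" if "k < ?n" "v i \<in> verts (Cs ! k)" for k
    using chain_order_cut_vertex_index[OF G order] v[OF i(2)] i(2) that by blast
  \<comment> \<open>As \<open>v i\<close> lies only in cycles \<open>i\<close> and
    \<open>Suc i\<close>, for \<open>k \<noteq> i\<close> the vertex \<open>v k\<close> differs from
    it, survives the deletion and links cycles \<open>k\<close> and \<open>Suc k\<close>.\<close>
  have step: "P k \<longleftrightarrow> P (Suc k)" if k: "Suc k < ?n" "k \<noteq> i" for k
  proof -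
    have mem: "v k \<in> verts (Cs ! k)" "v k \<in> verts (Cs ! Suc k)" using v[OF k(1)] by auto
    have "v k \<noteq> v i" using vi[of k] vi[of "Suc k"] mem k by auto
    then have mem': "v k \<in> verts (Cs ! k) - {v i}" "v k \<in> verts (Cs ! Suc k) - {v i}"
      using mem by auto
    show ?thesis
    proof
      assume "P k"
      then have "(w, v k) \<in> ?R" using mem'(1) unfolding P_def by blast
      then show "P (Suc k)" by (rule link[OF k(1) mem'(2)])
    next
      assume "P (Suc k)"
      then have "(w, v k) \<in> ?R" using mem'(2) unfolding P_def by blast
      then show "P k" by (rule link[OF Suc_lessD[OF k(1)] mem'(1)])
    qed
  qed
  have left: "P k \<longleftrightarrow> P 0" if "k \<le> i" for k
    using that by (induction k) (use step i in auto)
  have right: "P (Suc i + k) \<longleftrightarrow> P (Suc i)" if "Suc i + k < ?n" for k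
    using that by (induction k) (use step in auto)
  \<comment> \<open>Cycle \<open>a\<close> lies to the left of the gap at \<open>v i\<close> and
    cycle \<open>b\<close> to the right; their common vertex \<open>w\<close> bridges it.\<close>
  have "P a" "P b" using link[of a w] link[of b w] wa wb wv ab by auto
  then have "P k" if "k < ?n" for k
    using left[of a] left[of k] right[of "b - Suc i"] right[of "k - Suc i"] ab that
    by (cases "k \<le> i") auto
  moreover have "\<exists>k < ?n. x \<in> verts (Cs ! k)" if "x \<in> verts G" for x
    using that order unfolding chain_cactus_verts[OF G] chain_order_def by (metis UN_E in_set_conv_nth)
  ultimately have "(w, x) \<in> ?R" if "x \<in> verts G - {v i}" for x
    using that unfolding P_def by blast
  then have "\<not> cut_vertex G (v i)"
    unfolding cut_vertex_def by (meson symR rtrancl_trans)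
  then show False using v[OF i(2)] by blast
qed

section \<open>From ortho-position to the closed form\<close>

lemma in_position_1_edge:
  assumes C: "cycle_graph C" and pos: "in_position G C 1"
    and u: "u \<in> verts C" "cut_vertex G u" and v: "v \<in> verts C" "cut_vertex G v" and uv: "u \<noteq> v"
  shows "{u, v} \<in> edges C"
proof -
  obtain a b where ab: "{w \<in> verts C. cut_vertex G w} = {a, b}" "graph_dist C a b = 1"
    using pos by (auto simp: in_position_def)
  have uv': "{a, b} = {u, v}" 
  proof -
    have "u \<in> {a, b}" "v \<in> {a, b}" unfolding ab(1)[symmetric] using u v by simp_all
    then show ?thesis using uv by auto
  qed
  then have "a \<in> verts C" "b \<in> verts C" using u v by (auto simp: doubleton_eq_iff)
  then have "\<exists>k. (a, b) \<in> adj C ^^ k" using cycle_connected[OF C] by (simp add: rtrancl_power)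
  \<comment> \<open>The \<open>LEAST\<close> is attained because a cycle is connected, so distance 1
    is a genuine walk of one step, that is, an edge.\<close>
  then have "(a, b) \<in> adj C ^^ graph_dist C a b" unfolding graph_dist_def by (rule LeastI_ex)
  then show ?thesis using ab(2) uv' by (simp add: adj_def)
qed

text \<open>The gluing vertices are the shared cut vertices, completed by one neighbour in each end
  cycle. Ortho-position makes consecutive ones adjacent, and the intersection properties let each
  cycle meet its predecessors in one vertex only.\<close>

lemma indep_poly_ortho_chain:
  assumes ortho: "ortho_chain h n G" and n: "1 \<le> n"
  shows "indep_poly G = fst (chain_gf h n) + snd (chain_gf h n)"
proof -
  obtain Cs where G: "chain_cactus G" and card: "\<And>C. C \<in> cycles G \<Longrightarrow> card (verts C) = h"
    and len: "card (cycles G) = n" and order: "chain_order G Cs"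
    and pos: "\<And>i. 0 < i \<Longrightarrow> Suc i < length Cs \<Longrightarrow> in_position G (Cs ! i) 1"
    using ortho by (auto simp: ortho_chain_def chain_h_cactus_def chain_length_def)
  have d: "distinct Cs" and set: "set Cs = cycles G" using order by (auto simp: chain_order_def)
  have n': "length Cs = n" using distinct_card[OF d] set len by simp
  have cyc: "Cs ! k \<in> cycles G" "cycle_graph (Cs ! k)" if "k < n" for k
    using set n' that nth_mem[of k Cs] by (auto simp: cycles_def)
  obtain v where v: "\<And>i. Suc i < length Cs \<Longrightarrow>
      cut_vertex G (v i) \<and> verts (Cs ! i) \<inter> verts (Cs ! Suc i) = {v i}"
    using order unfolding chain_order_def by metis
  note inter = chain_order_inter[OF G order v]
  \<comment> \<open>The end cycles lack a second gluing vertex, so any neighbour of the shared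
    vertex is taken; a single cycle offers any of its edges.\<close>
  have ends: "\<exists>p q. if n = 1 then {p, q} \<in> edges (Cs ! 0)
      else {p, v 0} \<in> edges (Cs ! 0) \<and> {v (n - 2), q} \<in> edges (Cs ! (n - 1))"
  proof (cases "n = 1")
    case True
    have "verts (Cs ! 0) \<noteq> {}"
      using cyc(2)[of 0] n by (auto simp: cycle_graph_def)
    then obtain u where "u \<in> verts (Cs ! 0)" by blast
    then show ?thesis using cycle_neighbour[OF cyc(2)[of 0]] n True by (metis less_one)
  next
    case False
    then have "v 0 \<in> verts (Cs ! 0)" "v (n - 2) \<in> verts (Cs ! (n - 1))"
      using v[of 0] v[of "n - 2"] n n' by (auto simp: numeral_2_eq_2 Suc_diff_Suc)
    moreover have "0 < n" "n - 1 < n" using n by auto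
    ultimately show ?thesis
      using False cycle_neighbour[OF cyc(2)] by (metis insert_commute)
  qed
  then obtain p q where pq1: "n = 1 \<Longrightarrow> {p, q} \<in> edges (Cs ! 0)"
    and p: "n \<noteq> 1 \<Longrightarrow> {p, v 0} \<in> edges (Cs ! 0)"
    and q: "n \<noteq> 1 \<Longrightarrow> {v (n - 2), q} \<in> edges (Cs ! (n - 1))"
    by (cases "n = 1") auto
  \<comment> \<open>The index is shifted: \<open>v i\<close> is shared by cycles \<open>i\<close>
    and \<open>Suc i\<close>, whereas \<open>w k\<close> is the vertex at which cycle
    \<open>k\<close> is attached.\<close>
  define w where "w k = (if k = 0 then p else if k < n then v (k - 1) else q)" for k
  have e: "{w k, w (Suc k)} \<in> edges (Cs ! k)" if k: "k < n" for k
  proof -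
    consider "n = 1" "k = 0" | "n \<noteq> 1" "k = 0" | "n \<noteq> 1" "Suc k = n" | j where "k = Suc j" "Suc k < n"
      using k by (metis less_one not_less_eq not0_implies_Suc less_antisym)
    then show ?thesis
    proof cases
      case 4
      have j: "Suc j < length Cs" "Suc k < length Cs" using 4 n' by auto
      have vj: "cut_vertex G (v j)" "v j \<in> verts (Cs ! j)" "v j \<in> verts (Cs ! k)" using v[OF j(1)] 4 by auto
      have vk: "cut_vertex G (v k)" "v k \<in> verts (Cs ! k)" "v k \<in> verts (Cs ! Suc k)" using v[OF j(2)] by auto
      \<comment> \<open>\<open>v k\<close> lies only in cycles \<open>k\<close> and
        \<open>Suc k\<close>, while \<open>v j\<close> lies in the earlier cycle
        \<open>j\<close>.\<close>
      have "v j \<noteq> v k"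
        using chain_order_cut_vertex_index[OF G order vk(1) _ j(2), of j] vj(2) vk(2,3) j 4(1) by auto
      then have "{v j, v k} \<in> edges (Cs ! k)"
        using in_position_1_edge[OF cyc(2)[OF k] pos[of k] vj(3,1) vk(2,1)] j 4(1) by simp
      then show ?thesis using 4 by (simp add: w_def)
    next
      case 3
      then have "k = n - 1" "k - 1 = n - 2" "k \<noteq> 0" by auto
      then show ?thesis using q 3 by (simp add: w_def)
    qed (use pq1 p n in \<open>auto simp: w_def\<close>)
  qed
  \<comment> \<open>Separation is applied at index \<open>k - 1\<close>, whose cut vertex is
    \<open>w k\<close>.\<close>
  have int: "verts (Cs ! j) \<inter> verts (Cs ! k) \<subseteq> {w k}" if "j < k" "k < length Cs" for j k
    using inter[of j "k - 1" k] that n' by (simp add: w_def)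
  have p0: "p \<in> verts (Cs ! 0)"
    using cycle_edge_subset[OF cyc(2)[of 0]] pq1 p n by (cases "n = 1") auto
  have w0: "w 0 \<notin> verts (Cs ! k)" if k: "0 < k" "k < length Cs" for k
  proof
    assume "w 0 \<in> verts (Cs ! k)"
    \<comment> \<open>Separation at index 0 would identify \<open>p\<close> with \<open>v 0\<close>,
      although the two are the ends of an edge.\<close>
    then have "p = v 0" using inter[of 0 0 k] p0 k by (auto simp: w_def)
    moreover have "{p, v 0} \<in> edges (Cs ! 0)" using p k n' by auto
    then have "card {p, v 0} = 2"
      using cyc(1)[of 0] n by (auto simp: cycles_def subgraph_def simple_graph_def)
    ultimately show False by simp
  qed
  have cyc_card: "cycle_graph (Cs ! k) \<and> card (verts (Cs ! k)) = h" if "k < length Cs" for k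
    using cyc card that n' by blast
  have all: "cycles G = (\<lambda>j. Cs ! j) ` {..<n}" using set n' by (auto simp: set_conv_nth)
  have "chain_prefix (w 0) Cs n = G"
  proof -
    have "verts G = (\<Union>j<n. verts (Cs ! j))" using chain_cactus_verts[OF G] all by simp
    moreover have "edges G = (\<Union>j<n. edges (Cs ! j))" using chain_cactus_edges[OF G] all by simp
    moreover have "w 0 \<in> (\<Union>j<n. verts (Cs ! j))" using p0 n by (auto simp: w_def)
    ultimately show ?thesis by (simp add: chain_prefix_def insert_absorb)
  qed
  then have "chain_gf h n = (gf_avoid G (w n), gf_contain G (w n))"
    using gf_chain_prefix[OF cyc_card e int w0, of n] n' by simp
  moreover have "finite (verts G)" using chain_cactus_simple[OF G] by (simp add: simple_graph_def)
  ultimately show ?thesis using indep_poly_split[of G "w n"] by simp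
qed

theorem theorem3:
  fixes h n :: nat
    and G\<^sub>0 :: "'a ugraph" and G\<^sub>1 :: "'b ugraph" and G\<^sub>2 :: "'c ugraph"
  assumes "3 \<le> h" and "3 \<le> n"
    and "ortho_chain h n G\<^sub>0"
    and "ortho_chain h (n - 1) G\<^sub>1"
    and "ortho_chain h (n - 2) G\<^sub>2"
  shows "indep_poly G\<^sub>0 =
           monom 1 1 * (indep_poly (path_graph (h - 3)))\<^sup>2 * indep_poly G\<^sub>2
           + indep_poly (path_graph (h - 2)) * indep_poly G\<^sub>1"
proof -
  \<comment> \<open>From \<open>3 \<le> n\<close> comes \<open>1 \<le> m\<close>, so that even the
    shortest of the three chains has a cycle and the closed form applies to it.\<close>
  obtain m where m: "n = Suc (Suc m)" "1 \<le> m"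
    using assms(2) by (intro that[of "n - 2"]) auto
  then have "n - 1 = Suc m" "n - 2 = m" by auto
  then show ?thesis
    using indep_poly_ortho_chain[OF assms(3)] indep_poly_ortho_chain[OF assms(4)]
      indep_poly_ortho_chain[OF assms(5)] chain_gf_recurrence[of h m] m by simp
qed

end
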